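(* Let $n\ge 1$ be an integer and let $(X,\mu)$ be a finite measure space. For all $1\le i\le n$, let $P_i=p_i\mu$ and $Q_i=q_i\mu$ be probability measures on $X$, absolutely continuous with respect to $\mu$, whose density functions $p_i$ and $q_i$ are nonzero $\mu$-a.e. Let $f_i:(0,\infty)\to\mathbb{R}^+$, $1\le i\le n$, be concave functions. Write $\vec{\mathbf f}=(f_1,\dots,f_n)$, $\vec{\mathbf P}=(P_1,\dots,P_n)$, $\vec{\mathbf Q}=(Q_1,\dots,Q_n)$. Then $$\big[D_{\vec{\mathbf f}}(\vec{\mathbf P},\vec{\mathbf Q})\big]^n\le\prod_{i=1}^n D_{f_i}(P_i,Q_i)\le\prod_{i=1}^n f_i(1).$$ If in addition all $f_i$ are strictly concave, equality holds (throughout this chain) if and only if there is a probability density $p$ such that for all $i=1,2,\dots,n$, $p_i=q_i=p$ $\mu$-a.e.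
   Context: $\mathbb{R}^+=\{x\in\mathbb{R}:x\ge 0\}$. Mixed $f$-divergence: $$D_{\vec{\mathbf f}}(\vec{\mathbf P},\vec{\mathbf Q})=\int_X\prod_{i=1}^n\left[f_i\left(\frac{p_i}{q_i}\right)q_i\right]^{1/n}d\mu .$$ Classical $f$-divergence: $D_f(P,Q)=\int_X f\left(\frac pq\right)q\,d\mu$ for probability measures $P=p\mu$, $Q=q\mu$. *)

theory Defs
  imports "HOL-Probability.Probability"
begin

text \<open>
  A real function on \<open>(0,\<infinity>)\<close> is rendered as a total function \<open>real \<Rightarrow> real\<close> of which only
  the values on \<open>{0<..}\<close> matter.
\<close>

definition strictly_concave_on :: "real set \<Rightarrow> (real \<Rightarrow> real) \<Rightarrow> bool" where
  "strictly_concave_on S f \<longleftrightarrow> convex S \<and>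
     (\<forall>x\<in>S. \<forall>y\<in>S. \<forall>t. x \<noteq> y \<longrightarrow> 0 < t \<longrightarrow> t < 1 \<longrightarrow>
        (1 - t) * f x + t * f y < f ((1 - t) * x + t * y))"

definition probability_density :: "'a measure \<Rightarrow> ('a \<Rightarrow> real) \<Rightarrow> bool" where
  "probability_density M p \<longleftrightarrow>
     p \<in> borel_measurable M \<and> (AE x in M. 0 \<le> p x) \<and>
     prob_space (density M (\<lambda>x. ennreal (p x)))"

text \<open>The real-valued version of the Radon--Nikodym density \<open>dP/d\<mu>\<close>, with \<open>\<mu>\<close> given by \<open>M\<close>.\<close>

definition real_density :: "'a measure \<Rightarrow> 'a measure \<Rightarrow> 'a \<Rightarrow> real" where
  "real_density M P x = enn2real (RN_deriv M P x)"

text \<open>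
  The divergences below are for nonnegative functions \<open>f\<close> on \<open>(0,\<infinity>)\<close>. The integrands are then
  nonnegative, so the integrals are taken in \<open>[0,\<infinity>]\<close>: no integrability condition is needed, and a
  divergent integral has the value \<open>\<infinity>\<close>. If the densities are nonzero almost everywhere, only the
  values of \<open>f\<close> on \<open>(0,\<infinity>)\<close> contribute.
\<close>

definition f_divergence ::
    "'a measure \<Rightarrow> (real \<Rightarrow> real) \<Rightarrow> 'a measure \<Rightarrow> 'a measure \<Rightarrow> ennreal" where
  "f_divergence M f P Q =
     (\<integral>\<^sup>+ x. ennreal (f (real_density M P x / real_density M Q x) * real_density M Q x) \<partial>M)"

definition mixed_f_divergence ::
    "'a measure \<Rightarrow> nat \<Rightarrow> (nat \<Rightarrow> real \<Rightarrow> real) \<Rightarrow> (nat \<Rightarrow> 'a measure) \<Rightarrow> (nat \<Rightarrow> 'a measure) \<Rightarrow> ennreal"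
  where
  "mixed_f_divergence M n f P Q =
     (\<integral>\<^sup>+ x. ennreal (\<Prod>i=1..n.
        (f i (real_density M (P i) x / real_density M (Q i) x) * real_density M (Q i) x)
          powr (1 / real n)) \<partial>M)"

end

theory Submission
  imports Defs
begin

text \<open>
  Put \<open>g\<^sub>i = f\<^sub>i (p\<^sub>i / q\<^sub>i) q\<^sub>i\<close>. Both inequalities come from integrating a pointwise one.

  The first is Hoelder's inequality for the \<open>n\<close> functions \<open>g\<^sub>i\<close>, all with exponent \<open>n\<close>. After
  division by \<open>D\<^sub>i = \<integral> g\<^sub>i d\<mu>\<close> it is the integrated inequality between the geometric and the arithmetic
  mean of the numbers \<open>g\<^sub>i x / D\<^sub>i\<close> (lemma \<open>Holder_geometric_mean\<close>). The second is Jensen's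
  inequality: a concave function lies below a line \<open>f 1 + c (t - 1)\<close> through its value at \<open>1\<close>, and at
  \<open>t = p / q\<close>, after multiplication by \<open>q\<close>, the linear term becomes \<open>c (p - q)\<close>, whose integral
  vanishes (lemma \<open>perspective_integral_le\<close>). This bound also shows that every \<open>D\<^sub>i\<close> is finite, so
  the argument can be carried out with real integrals.

  In the equality case both pointwise inequalities are equalities almost everywhere. Strictly
  concave nonnegative functions are positive, so the products can be compared factor by factor and
  \<open>D\<^sub>i = f\<^sub>i 1 > 0\<close> for each \<open>i\<close>. A strictly concave function meets its supporting line only at \<open>1\<close>,
  hence \<open>p\<^sub>i = q\<^sub>i\<close>. Then \<open>g\<^sub>i / D\<^sub>i = q\<^sub>i\<close>, and equality between the two means forces the \<open>q\<^sub>i\<close> to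
  coincide. Conversely, if \<open>p\<^sub>i = q\<^sub>i = p\<close>, then \<open>g\<^sub>i = f\<^sub>i 1 * p\<close>, and all three members of the
  chain are equal to the product of the \<open>f\<^sub>i 1\<close>.
\<close>

section \<open>Equality of the arithmetic and the geometric mean\<close>

text \<open>
  Let \<open>A\<close> be the arithmetic mean. For positive \<open>x i\<close>, equality says that the numbers
  \<open>(x i / A - 1) - ln (x i / A)\<close> have sum zero. All of them are nonnegative, so all of them vanish,
  which happens only if \<open>x i = A\<close>.
\<close>

lemma arith_geom_mean_eq_imp_const:
  fixes x :: "'i \<Rightarrow> real"
  assumes S: "finite S" "S \<noteq> {}" and x: "\<And>i. i \<in> S \<Longrightarrow> 0 \<le> x i"
    and eq: "(\<Prod>i\<in>S. x i powr (1 / card S)) = (\<Sum>i\<in>S. x i) / card S"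
    and i: "i \<in> S"
  shows "x i = (\<Sum>i\<in>S. x i) / card S"
proof (cases "\<exists>j\<in>S. x j = 0")
  case True
  then have "(\<Prod>i\<in>S. x i powr (1 / card S)) = 0"
    using S by (auto simp: prod_zero_iff)
  then have "(\<Sum>i\<in>S. x i) = 0"
    using eq S by (simp add: card_gt_0_iff)
  then show ?thesis
    using sum_nonneg_eq_0_iff[of S x] S x i by auto
next
  case False
  then have pos: "0 < x j" if "j \<in> S" for j
    using x that by (metis order_le_less)
  define A where "A = (\<Sum>i\<in>S. x i) / card S"
  have card: "real (card S) > 0"
    using S by (simp add: card_gt_0_iff)
  have A: "A > 0"
    unfolding A_def using S pos card by (intro divide_pos_pos sum_pos) auto
  have "ln A = ln (\<Prod>i\<in>S. x i powr (1 / card S))"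
    using eq A_def by simp
  also have "\<dots> = (\<Sum>i\<in>S. ln (x i powr (1 / card S)))"
    using S pos by (intro ln_prod) (auto dest: pos)
  also have "\<dots> = (\<Sum>i\<in>S. ln (x i)) / card S"
    by (simp add: ln_powr sum_divide_distrib)
  finally have lnA: "(\<Sum>i\<in>S. ln (x i)) = card S * ln A"
    using card by (simp add: field_simps)
  define d where "d j = (x j / A - 1) - ln (x j / A)" for j
  have d_nonneg: "0 \<le> d j" if "j \<in> S" for j
    unfolding d_def using ln_le_minus_one[of "x j / A"] pos[OF that] A by simp
  have "(\<Sum>j\<in>S. d j) = (\<Sum>j\<in>S. x j) / A - card S - ((\<Sum>j\<in>S. ln (x j)) - card S * ln A)"
  proof -
    have "(\<Sum>j\<in>S. d j) = (\<Sum>j\<in>S. (x j / A - 1) - (ln (x j) - ln A))"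
      unfolding d_def using A by (intro sum.cong refl) (use pos in \<open>fastforce simp: ln_div\<close>)
    then show ?thesis
      by (simp add: sum_subtractf sum_divide_distrib)
  qed
  also have "\<dots> = 0"
    using lnA A card by (simp add: A_def field_simps)
  finally have "d i = 0"
    using sum_nonneg_eq_0_iff[of S d] S d_nonneg i by auto
  then have "x i / A = 1"
    using ln_eq_minus_one[of "x i / A"] pos[OF i] A by (simp add: d_def)
  then show ?thesis
    using A by (simp add: A_def[symmetric])
qed

section \<open>Hoelder's inequality for geometric means\<close>

lemma powr_inverse_power:
  fixes x :: real
  assumes "0 \<le> x" "0 < n"
  shows "(x powr (1 / real n)) ^ n = x"
  using assms by (cases "x = 0") (simp_all add: powr_realpow[symmetric] powr_powr)

text \<open>
  The common core of the inequality and of its equality case: for functions normalised to integral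
  one, the integral of the arithmetic mean is one, and the geometric mean lies below it.
\<close>

lemma geometric_mean_of_normalised:
  fixes h :: "'i \<Rightarrow> 'a \<Rightarrow> real"
  assumes S: "finite S" "S \<noteq> {}"
    and int: "\<And>i. i \<in> S \<Longrightarrow> integrable M (h i)"
    and nonneg: "\<And>i. i \<in> S \<Longrightarrow> AE x in M. 0 \<le> h i x"
    and one: "\<And>i. i \<in> S \<Longrightarrow> (\<integral>x. h i x \<partial>M) = 1"
  defines "G \<equiv> \<lambda>x. \<Prod>i\<in>S. h i x powr (1 / card S)"
  shows "integrable M G" and "(\<integral>x. G x \<partial>M) \<le> 1"
    and "(\<integral>x. G x \<partial>M) = 1 \<Longrightarrow> AE x in M. \<forall>i\<in>S. \<forall>j\<in>S. h i x = h j x"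
proof -
  define A where "A x = (\<Sum>i\<in>S. h i x) / card S" for x
  have card: "real (card S) > 0"
    using S by (simp add: card_gt_0_iff)
  have meas: "h i \<in> borel_measurable M" if "i \<in> S" for i
    using int[OF that] by auto
  have G_meas: "G \<in> borel_measurable M"
    unfolding G_def using meas by measurable
  have A_int: "integrable M A"
    unfolding A_def using int by auto
  have A_one: "(\<integral>x. A x \<partial>M) = 1"
    unfolding A_def using int one card by (simp add: Bochner_Integration.integral_sum)
  have nn: "AE x in M. \<forall>i\<in>S. 0 \<le> h i x"
    using nonneg S by (simp add: AE_finite_all)
  have GA: "G x \<le> A x" if "\<forall>i\<in>S. 0 \<le> h i x" for x
    using arith_geom_mean[OF S, of "\<lambda>i. h i x"] that
    by (simp add: G_def A_def prod_powr_distrib sum_divide_distrib)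
  have G_nonneg: "0 \<le> G x" for x
    unfolding G_def by (intro prod_nonneg) auto
  show G_int: "integrable M G"
    by (rule Bochner_Integration.integrable_bound[OF A_int G_meas])
      (use nn in eventually_elim, use GA G_nonneg in \<open>force simp: abs_of_nonneg\<close>)
  have AE_GA: "AE x in M. G x \<le> A x"
    using nn by eventually_elim (rule GA)
  show "(\<integral>x. G x \<partial>M) \<le> 1"
    using integral_mono_AE[OF G_int A_int AE_GA] A_one by simp
  assume "(\<integral>x. G x \<partial>M) = 1"
  then have "(\<integral>x. A x - G x \<partial>M) = 0"
    using G_int A_int A_one by simp
  then have "AE x in M. A x - G x = 0"
    using integral_nonneg_eq_0_iff_AE[of M "\<lambda>x. A x - G x"] G_int A_int AE_GA by auto
  with nn show "AE x in M. \<forall>i\<in>S. \<forall>j\<in>S. h i x = h j x"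
  proof eventually_elim
    case (elim x)
    have "G x = A x"
      using elim by simp
    then have "h i x = A x" if "i \<in> S" for i
      unfolding A_def G_def
      by (intro arith_geom_mean_eq_imp_const[OF S _ _ that]) (use elim in auto)
    then show ?case
      by simp
  qed
qed

text \<open>
  Normalise each function to integral one. A function of integral zero cannot be normalised, but it
  vanishes almost everywhere, and so does the geometric mean.
\<close>

lemma Holder_geometric_mean:
  fixes g :: "'i \<Rightarrow> 'a \<Rightarrow> real"
  assumes S: "finite S" "S \<noteq> {}"
    and int: "\<And>i. i \<in> S \<Longrightarrow> integrable M (g i)"
    and nonneg: "\<And>i. i \<in> S \<Longrightarrow> AE x in M. 0 \<le> g i x"
  defines "G \<equiv> \<lambda>x. \<Prod>i\<in>S. g i x powr (1 / card S)"
  shows "integrable M G"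
    and "(\<integral>x. G x \<partial>M) ^ card S \<le> (\<Prod>i\<in>S. \<integral>x. g i x \<partial>M)"
    and "(\<integral>x. G x \<partial>M) ^ card S = (\<Prod>i\<in>S. \<integral>x. g i x \<partial>M) \<Longrightarrow>
      (\<And>i. i \<in> S \<Longrightarrow> (\<integral>x. g i x \<partial>M) > 0) \<Longrightarrow>
      AE x in M. \<forall>i\<in>S. \<forall>j\<in>S. g i x / (\<integral>x. g i x \<partial>M) = g j x / (\<integral>x. g j x \<partial>M)"
proof -
  define d where "d i = (\<integral>x. g i x \<partial>M)" for i
  have card: "card S > 0"
    using S by (simp add: card_gt_0_iff)
  have d_nonneg: "0 \<le> d i" if "i \<in> S" for i
    unfolding d_def using nonneg[OF that] by (rule integral_nonneg_AE)
  have "integrable M G \<and> (\<integral>x. G x \<partial>M) ^ card S \<le> (\<Prod>i\<in>S. d i) \<and>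
    ((\<integral>x. G x \<partial>M) ^ card S = (\<Prod>i\<in>S. d i) \<longrightarrow> (\<forall>i\<in>S. d i > 0) \<longrightarrow>
      (AE x in M. \<forall>i\<in>S. \<forall>j\<in>S. g i x / d i = g j x / d j))"
  proof (cases "\<exists>i\<in>S. d i = 0")
    case True
    then obtain k where k: "k \<in> S" "d k = 0"
      by blast
    have G_meas: "G \<in> borel_measurable M"
      unfolding G_def using borel_measurable_integrable[OF int] by measurable
    have "AE x in M. g k x = 0"
      using k integral_nonneg_eq_0_iff_AE[OF int nonneg, of k] by (simp add: d_def)
    then have G0: "AE x in M. G x = 0"
      by eventually_elim (use S k in \<open>auto simp: G_def\<close>)
    have "integrable M G"
      using integrable_cong_AE[OF G_meas _ G0] by simp
    moreover have "(\<integral>x. G x \<partial>M) = 0"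
      using integral_cong_AE[OF G_meas _ G0] by simp
    moreover have "(\<Prod>i\<in>S. d i) \<ge> 0"
      using d_nonneg by (rule prod_nonneg)
    ultimately show ?thesis
      using k card by (auto simp: zero_power)
  next
    case False
    then have d_pos: "0 < d i" if "i \<in> S" for i
      using d_nonneg[OF that] that by force
    define h where "h i x = g i x / d i" for i x
    define H where "H x = (\<Prod>i\<in>S. h i x powr (1 / card S))" for x
    define K where "K = (\<Prod>i\<in>S. d i powr (1 / card S))"
    have hint: "integrable M (h i)" if "i \<in> S" for i
      using int[OF that] by (simp add: h_def[abs_def])
    have hnn: "AE x in M. 0 \<le> h i x" if "i \<in> S" for i
      using nonneg[OF that] by eventually_elim (use d_pos[OF that] in \<open>simp add: h_def\<close>)
    have hone: "(\<integral>x. h i x \<partial>M) = 1" if "i \<in> S" for i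
      using d_pos[OF that] int[OF that] by (simp add: h_def[abs_def] d_def)
    have norm: "integrable M H" "(\<integral>x. H x \<partial>M) \<le> 1"
      "(\<integral>x. H x \<partial>M) = 1 \<Longrightarrow> AE x in M. \<forall>i\<in>S. \<forall>j\<in>S. h i x = h j x"
      using geometric_mean_of_normalised[of S M h] S hint hnn hone
      unfolding H_def[abs_def] by blast+
    have GH: "G x = K * H x" for x
    proof -
      have "g i x powr (1 / card S) = d i powr (1 / card S) * h i x powr (1 / card S)"
        if "i \<in> S" for i
        using d_pos[OF that] powr_mult[of "d i" "h i x" "1 / card S"] by (simp add: h_def)
      then show ?thesis
        by (simp add: G_def H_def K_def prod.distrib[symmetric] cong: prod.cong)
    qed
    have K_pos: "K > 0"
      unfolding K_def by (intro prod_pos) (use d_pos in force)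
    have "(d i powr (1 / card S)) ^ card S = d i" if "i \<in> S" for i
      using d_nonneg[OF that] card by (simp add: powr_inverse_power)
    then have K_pow: "K ^ card S = (\<Prod>i\<in>S. d i)"
      by (simp add: K_def prod_power_distrib cong: prod.cong)
    have H_nonneg: "0 \<le> (\<integral>x. H x \<partial>M)"
      by (intro integral_nonneg_AE) (auto simp: H_def intro!: prod_nonneg)
    have G_pow: "(\<integral>x. G x \<partial>M) ^ card S = (\<integral>x. H x \<partial>M) ^ card S * (\<Prod>i\<in>S. d i)"
      using K_pow by (simp add: GH power_mult_distrib mult.commute)
    have prod_pos: "(\<Prod>i\<in>S. d i) > 0"
      using K_pow K_pos by (metis zero_less_power)
    have "integrable M G"
      unfolding GH[abs_def] using norm(1) by simp
    moreover have "(\<integral>x. G x \<partial>M) ^ card S \<le> (\<Prod>i\<in>S. d i)"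
      unfolding G_pow using norm(2) H_nonneg prod_pos power_le_one[of "\<integral>x. H x \<partial>M"]
      by (simp add: mult_le_cancel_right1)
    moreover have "AE x in M. \<forall>i\<in>S. \<forall>j\<in>S. h i x = h j x"
      if "(\<integral>x. G x \<partial>M) ^ card S = (\<Prod>i\<in>S. d i)"
    proof -
      have "(\<integral>x. H x \<partial>M) ^ card S = 1"
        using that prod_pos by (simp add: G_pow)
      then have "(\<integral>x. H x \<partial>M) = 1"
        using H_nonneg card power_eq_1_iff[of "\<integral>x. H x \<partial>M" "card S"] by auto
      then show ?thesis
        by (rule norm(3))
    qed
    ultimately show ?thesis
      by (simp add: h_def)
  qed
  then show "integrable M G"
    and "(\<integral>x. G x \<partial>M) ^ card S \<le> (\<Prod>i\<in>S. \<integral>x. g i x \<partial>M)"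
    and "(\<integral>x. G x \<partial>M) ^ card S = (\<Prod>i\<in>S. \<integral>x. g i x \<partial>M) \<Longrightarrow>
      (\<And>i. i \<in> S \<Longrightarrow> (\<integral>x. g i x \<partial>M) > 0) \<Longrightarrow>
      AE x in M. \<forall>i\<in>S. \<forall>j\<in>S. g i x / (\<integral>x. g i x \<partial>M) = g j x / (\<integral>x. g j x \<partial>M)"
    by (auto simp: d_def)
qed

section \<open>Supporting lines and Jensen's inequality\<close>

text \<open>The slope \<open>c\<close> is a one-sided derivative of \<open>f\<close> at \<open>a\<close>, obtained from the convex function \<open>- f\<close>.\<close>

lemma concave_on_supporting_line:
  fixes f :: "real \<Rightarrow> real"
  assumes "concave_on {0<..} f" and "0 < a"
  obtains c where "\<And>t. 0 < t \<Longrightarrow> f t \<le> f a + c * (t - a)"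
proof -
  have "convex_on {0<..} (\<lambda>t. - f t)"
    using assms(1) by (simp add: concave_on_def)
  then obtain c where c: "\<And>t. 0 < t \<Longrightarrow> - f a + c * (t - a) \<le> - f t"
    using convex_le_Inf_differential[of "{0<..}" "\<lambda>t. - f t" a] assms(2)
    by (force simp: interior_open)
  show thesis
    by (rule that[of "- c"]) (use c in force)
qed

text \<open>
  If the graph met the line again at \<open>t\<close>, strict concavity would lift it above the line at the
  midpoint of \<open>a\<close> and \<open>t\<close>.
\<close>

lemma strictly_concave_below_supporting_line:
  assumes f: "strictly_concave_on {0<..} f"
    and line: "\<And>t. 0 < t \<Longrightarrow> f t \<le> f a + c * (t - a)"
    and "0 < a" "0 < t" "t \<noteq> a"
  shows "f t < f a + c * (t - a)"
proof (rule ccontr)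
  assume "\<not> ?thesis"
  moreover have "(1 - 1/2) * f a + 1/2 * f t < f ((1 - 1/2) * a + 1/2 * t)"
    using f[unfolded strictly_concave_on_def, THEN conjunct2, rule_format, of a t "1/2"] assms(3-5)
    by simp
  moreover have "f ((1 - 1/2) * a + 1/2 * t) \<le> f a + c * (((1 - 1/2) * a + 1/2 * t) - a)"
    by (rule line) (use assms(3,4) in simp)
  ultimately show False
    by (simp add: algebra_simps)
qed

text \<open>
  Any interior point of \<open>(0,\<infinity>)\<close> is the midpoint of two others, here \<open>a / 2\<close> and \<open>3 a / 2\<close>, and its
  value strictly exceeds the mean of their nonnegative values.
\<close>

lemma strictly_concave_nonneg_imp_pos:
  assumes f: "strictly_concave_on {0<..} f" and nonneg: "\<And>t. 0 < t \<Longrightarrow> 0 \<le> f t"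
    and a: "0 < (a::real)"
  shows "0 < f a"
proof -
  have "(1 - 1/2) * f (a/2) + 1/2 * f (3*a/2) < f ((1 - 1/2) * (a/2) + 1/2 * (3*a/2))"
    using f[unfolded strictly_concave_on_def, THEN conjunct2, rule_format, of "a/2" "3*a/2" "1/2"] a
    by simp
  moreover have "(1 - 1/2) * (a/2) + 1/2 * (3*a/2) = a"
    by simp
  ultimately show ?thesis
    using nonneg[of "a/2"] nonneg[of "3*a/2"] a by simp
qed

text \<open>
  The perspective of \<open>f\<close>. Extending \<open>f\<close> by zero outside \<open>(0,\<infinity>)\<close>, where it is arbitrary, makes the
  composition with measurable functions measurable.
\<close>

definition perspective :: "(real \<Rightarrow> real) \<Rightarrow> real \<Rightarrow> real \<Rightarrow> real" where
  "perspective f a b = (if 0 < a / b then f (a / b) else 0) * b"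

lemma perspective_pos [simp]: "0 < a \<Longrightarrow> 0 < b \<Longrightarrow> perspective f a b = f (a / b) * b"
  by (simp add: perspective_def)

lemma perspective_measurable:
  assumes f: "concave_on {0<..} f"
    and [measurable]: "p \<in> borel_measurable M" "q \<in> borel_measurable M"
  shows "(\<lambda>x. perspective f (p x) (q x)) \<in> borel_measurable M"
proof -
  have "continuous_on {0<..} (\<lambda>t. - f t)"
    using f by (intro convex_on_continuous) (auto simp: concave_on_def)
  then have "continuous_on {0<..} f"
    using continuous_on_minus by force
  then have "(\<lambda>t. indicator {0<..} t *\<^sub>R f t) \<in> borel_measurable borel"
    by (intro borel_measurable_continuous_on_indicator) auto
  also have "(\<lambda>t. indicator {0<..} t *\<^sub>R f t) = (\<lambda>t. if 0 < t then f t else 0)"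
    by (auto simp: fun_eq_iff)
  finally have [measurable]: "(\<lambda>t. if 0 < t then f t else 0) \<in> borel_measurable borel" .
  have "(\<lambda>x. (if 0 < p x / q x then f (p x / q x) else 0) * q x) \<in> borel_measurable M"
    by (rule borel_measurable_times[OF measurable_compose[of "\<lambda>x. p x / q x" M borel
          "\<lambda>t. if 0 < t then f t else 0"]]) measurable
  then show ?thesis
    by (simp add: perspective_def)
qed

text \<open>
  The supporting line \<open>f 1 + c (t - 1)\<close> turns into the bound \<open>f 1 * q + c * (p - q)\<close>, whose integral
  is \<open>f 1\<close> because \<open>p\<close> and \<open>q\<close> have the same integral.
\<close>

lemma perspective_integral_le:
  assumes f: "concave_on {0<..} f" and f_nonneg: "\<And>t. 0 < t \<Longrightarrow> 0 \<le> f t"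
    and p: "integrable M p" "(\<integral>x. p x \<partial>M) = 1" "AE x in M. 0 < p x"
    and q: "integrable M q" "(\<integral>x. q x \<partial>M) = 1" "AE x in M. 0 < q x"
  shows "integrable M (\<lambda>x. perspective f (p x) (q x))"
    and "(\<integral>x. perspective f (p x) (q x) \<partial>M) \<le> f 1"
    and "strictly_concave_on {0<..} f \<Longrightarrow> (\<integral>x. perspective f (p x) (q x) \<partial>M) = f 1 \<Longrightarrow>
      AE x in M. p x = q x"
proof -
  obtain c where c: "\<And>t. 0 < t \<Longrightarrow> f t \<le> f 1 + c * (t - 1)"
    using concave_on_supporting_line[OF f, of 1] by auto
  define L where "L x = f 1 * q x + c * (p x - q x)" for x
  have L_int: "integrable M L"
    unfolding L_def using p q by auto
  have L_eq: "(\<integral>x. L x \<partial>M) = f 1"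
    unfolding L_def using p q by simp
  have L_line: "L x = (f 1 + c * (p x / q x - 1)) * q x" if "0 < q x" for x
    using that by (simp add: L_def field_simps)
  have bound: "AE x in M. perspective f (p x) (q x) \<le> L x"
    using p(3) q(3)
  proof eventually_elim
    case (elim x)
    then show ?case
      using c[of "p x / q x"] by (simp add: L_line mult_right_mono)
  qed
  have nonneg: "AE x in M. 0 \<le> perspective f (p x) (q x)"
    using p(3) q(3) by eventually_elim (simp add: f_nonneg)
  show G_int: "integrable M (\<lambda>x. perspective f (p x) (q x))"
    by (rule Bochner_Integration.integrable_bound[OF L_int
          perspective_measurable[OF f borel_measurable_integrable[OF p(1)]
            borel_measurable_integrable[OF q(1)]]])
      (use bound nonneg in eventually_elim, simp)
  show "(\<integral>x. perspective f (p x) (q x) \<partial>M) \<le> f 1"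
    using integral_mono_AE[OF G_int L_int bound] L_eq by simp
  assume strict: "strictly_concave_on {0<..} f"
    and eq: "(\<integral>x. perspective f (p x) (q x) \<partial>M) = f 1"
  have "(\<integral>x. L x - perspective f (p x) (q x) \<partial>M) = 0"
    using G_int L_int L_eq eq by simp
  then have "AE x in M. L x - perspective f (p x) (q x) = 0"
    using integral_nonneg_eq_0_iff_AE[of M "\<lambda>x. L x - perspective f (p x) (q x)"]
      G_int L_int bound by auto
  with p(3) q(3) show "AE x in M. p x = q x"
  proof eventually_elim
    case (elim x)
    then have "f 1 + c * (p x / q x - 1) = f (p x / q x)"
      by (simp add: L_line)
    then have "p x / q x = 1"
      using strictly_concave_below_supporting_line[OF strict c, of "p x / q x"] elim
      by fastforce
    then show ?case
      using elim by simp
  qed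
qed

section \<open>Divergences as real integrals\<close>

lemma probability_density_integral:
  assumes "probability_density M p"
  shows "integrable M p" and "(\<integral>x. p x \<partial>M) = 1"
proof -
  have p: "p \<in> borel_measurable M" "AE x in M. 0 \<le> p x"
    using assms by (auto simp: probability_density_def)
  have "emeasure (density M (\<lambda>x. ennreal (p x))) (space M) = 1"
    using assms prob_space.emeasure_space_1 by (fastforce simp: probability_density_def)
  then have "(\<integral>\<^sup>+x. ennreal (p x) \<partial>M) = 1"
    using p by (simp add: emeasure_density cong: nn_integral_cong)
  then have "has_bochner_integral M p 1"
    using p by (intro has_bochner_integral_nn_integral) auto
  then show "integrable M p" and "(\<integral>x. p x \<partial>M) = 1"
    by (auto simp: has_bochner_integral_iff)
qed

text \<open>
  Finiteness of \<open>M\<close> gives uniqueness of Radon--Nikodym derivatives, so the divergences, defined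
  through the measures \<open>P\<^sub>i\<close> and \<open>Q\<^sub>i\<close>, can be computed from the given densities.
\<close>

lemma real_density_density:
  assumes "finite_measure M" and p: "probability_density M p"
  shows "AE x in M. real_density M (density M (\<lambda>x. ennreal (p x))) x = p x"
proof -
  interpret finite_measure M by fact
  have "AE x in M. ennreal (p x) = RN_deriv M (density M (\<lambda>x. ennreal (p x))) x"
    using p by (intro RN_deriv_unique) (auto simp: probability_density_def)
  moreover have "AE x in M. 0 \<le> p x"
    using p by (simp add: probability_density_def)
  ultimately show ?thesis
    by eventually_elim (metis real_density_def enn2real_ennreal)
qed

section \<open>Mixed and classical divergences\<close>

theorem theorem3p2:
  fixes n :: nat
    and M :: "'a measure"
    and P Q :: "nat \<Rightarrow> 'a measure"
    and p q :: "nat \<Rightarrow> 'a \<Rightarrow> real"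
    and f :: "nat \<Rightarrow> real \<Rightarrow> real"
  assumes "n \<ge> 1"
    and "finite_measure M"
    and "\<forall>i\<in>{1..n}. probability_density M (p i) \<and> P i = density M (\<lambda>x. ennreal (p i x))"
    and "\<forall>i\<in>{1..n}. probability_density M (q i) \<and> Q i = density M (\<lambda>x. ennreal (q i x))"
    and "\<forall>i\<in>{1..n}. (AE x in M. p i x \<noteq> 0) \<and> (AE x in M. q i x \<noteq> 0)"
    and "\<forall>i\<in>{1..n}. concave_on {0<..} (f i) \<and> (\<forall>t>0. 0 \<le> f i t)"
  shows "(mixed_f_divergence M n f P Q ^ n \<le> (\<Prod>i=1..n. f_divergence M (f i) (P i) (Q i)) \<and>
          (\<Prod>i=1..n. f_divergence M (f i) (P i) (Q i)) \<le> ennreal (\<Prod>i=1..n. f i 1)) \<and>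
    ((\<forall>i\<in>{1..n}. strictly_concave_on {0<..} (f i)) \<longrightarrow>
      ((mixed_f_divergence M n f P Q ^ n = (\<Prod>i=1..n. f_divergence M (f i) (P i) (Q i)) \<and>
        (\<Prod>i=1..n. f_divergence M (f i) (P i) (Q i)) = ennreal (\<Prod>i=1..n. f i 1)) \<longleftrightarrow>
       (\<exists>r. probability_density M r \<and>
          (\<forall>i\<in>{1..n}. AE x in M. p i x = r x \<and> q i x = r x))))"
proof -
  let ?I = "{1..n}"
  define g where "g i x = perspective (f i) (p i x) (q i x)" for i x
  define d where "d i = (\<integral>x. g i x \<partial>M)" for i
  define G where "G x = (\<Prod>i\<in>?I. g i x powr (1 / card ?I))" for x
  define m where "m = (\<integral>x. G x \<partial>M)"
  have I: "finite ?I" "?I \<noteq> {}"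
    using assms(1) by auto
  have pd: "probability_density M (p i)" "probability_density M (q i)" if "i \<in> ?I" for i
    using assms(3,4) that by auto
  have conc: "concave_on {0<..} (f i)" and f_nonneg: "0 < t \<Longrightarrow> 0 \<le> f i t" if "i \<in> ?I" for i t
    using assms(6) that by auto
  have pos: "AE x in M. 0 < p i x" "AE x in M. 0 < q i x" if "i \<in> ?I" for i
  proof -
    have "AE x in M. 0 \<le> p i x" "AE x in M. p i x \<noteq> 0" "AE x in M. 0 \<le> q i x" "AE x in M. q i x \<noteq> 0"
      using pd[OF that] assms(5) that by (auto simp: probability_density_def)
    then show "AE x in M. 0 < p i x" "AE x in M. 0 < q i x"
      by (eventually_elim, simp)+
  qed
  have jensen: "integrable M (g i)" "d i \<le> f i 1"
    "strictly_concave_on {0<..} (f i) \<Longrightarrow> d i = f i 1 \<Longrightarrow> AE x in M. p i x = q i x"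
    if "i \<in> ?I" for i
    using perspective_integral_le[OF conc[OF that] f_nonneg[OF that]
        probability_density_integral[OF pd(1)[OF that]] pos(1)[OF that]
        probability_density_integral[OF pd(2)[OF that]] pos(2)[OF that]]
    unfolding d_def g_def[abs_def] by blast+
  have g_nonneg: "AE x in M. 0 \<le> g i x" if "i \<in> ?I" for i
    using pos[OF that] by eventually_elim (use f_nonneg[OF that] in \<open>simp add: g_def\<close>)
  have d_nonneg: "0 \<le> d i" if "i \<in> ?I" for i
    unfolding d_def using g_nonneg[OF that] by (rule integral_nonneg_AE)
  have holder: "integrable M G" "m ^ card ?I \<le> (\<Prod>i\<in>?I. d i)"
    "m ^ card ?I = (\<Prod>i\<in>?I. d i) \<Longrightarrow> (\<And>i. i \<in> ?I \<Longrightarrow> d i > 0) \<Longrightarrow>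
      AE x in M. \<forall>i\<in>?I. \<forall>j\<in>?I. g i x / d i = g j x / d j"
    using Holder_geometric_mean[of ?I M g] I jensen(1) g_nonneg
    unfolding m_def d_def G_def[abs_def] by blast+
  have G_nonneg: "0 \<le> G x" for x
    unfolding G_def by (intro prod_nonneg) auto
  have m_nonneg: "0 \<le> m"
    unfolding m_def using G_nonneg by simp

  have integrand: "AE x in M. f i (real_density M (P i) x / real_density M (Q i) x) *
      real_density M (Q i) x = g i x" if "i \<in> ?I" for i
  proof -
    have "P i = density M (\<lambda>x. ennreal (p i x))" "Q i = density M (\<lambda>x. ennreal (q i x))"
      using assms(3,4) that by auto
    then have "AE x in M. real_density M (P i) x = p i x" "AE x in M. real_density M (Q i) x = q i x"
      using real_density_density[OF assms(2)] pd[OF that] by auto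
    with pos[OF that] show ?thesis
      by eventually_elim (simp add: g_def)
  qed
  have D: "f_divergence M (f i) (P i) (Q i) = ennreal (d i)" if "i \<in> ?I" for i
  proof -
    have "f_divergence M (f i) (P i) (Q i) = (\<integral>\<^sup>+x. ennreal (g i x) \<partial>M)"
      unfolding f_divergence_def using integrand[OF that] by (intro nn_integral_cong_AE) auto
    then show ?thesis
      using nn_integral_eq_integral[OF jensen(1) g_nonneg] that by (simp add: d_def)
  qed
  have mixed: "mixed_f_divergence M n f P Q = ennreal m"
  proof -
    have "AE x in M. \<forall>i\<in>?I. f i (real_density M (P i) x / real_density M (Q i) x) *
      real_density M (Q i) x = g i x"
      using integrand by (simp add: AE_finite_all)
    then have "mixed_f_divergence M n f P Q = (\<integral>\<^sup>+x. ennreal (G x) \<partial>M)"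
      unfolding mixed_f_divergence_def
      by (intro nn_integral_cong_AE, eventually_elim)
        (auto simp: G_def intro!: arg_cong[where f = ennreal] prod.cong)
    then show ?thesis
      using nn_integral_eq_integral[OF holder(1)] G_nonneg by (simp add: m_def)
  qed
  have prod_D: "(\<Prod>i=1..n. f_divergence M (f i) (P i) (Q i)) = ennreal (\<Prod>i\<in>?I. d i)"
  proof -
    have "(\<Prod>i\<in>?I. f_divergence M (f i) (P i) (Q i)) = (\<Prod>i\<in>?I. ennreal (d i))"
      by (intro prod.cong refl D)
    then show ?thesis
      using d_nonneg prod_ennreal[of ?I d] by simp
  qed
  have mixed_pow: "mixed_f_divergence M n f P Q ^ n = ennreal (m ^ n)"
    using m_nonneg by (simp add: mixed ennreal_power)
  have prod_d_nonneg: "0 \<le> (\<Prod>i\<in>?I. d i)"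
    using d_nonneg by (rule prod_nonneg)
  have f1_nonneg: "0 \<le> (\<Prod>i\<in>?I. f i 1)"
    using f_nonneg by (intro prod_nonneg) auto

  have first: "m ^ n \<le> (\<Prod>i\<in>?I. d i)"
    using holder(2) by simp
  have second: "(\<Prod>i\<in>?I. d i) \<le> (\<Prod>i\<in>?I. f i 1)"
    using d_nonneg jensen(2) by (intro prod_mono) auto

  have equality: "(m ^ n = (\<Prod>i\<in>?I. d i) \<and> (\<Prod>i\<in>?I. d i) = (\<Prod>i\<in>?I. f i 1)) \<longleftrightarrow>
    (\<exists>r. probability_density M r \<and> (\<forall>i\<in>?I. AE x in M. p i x = r x \<and> q i x = r x))"
    (is "?L \<longleftrightarrow> ?R") if strict: "\<forall>i\<in>?I. strictly_concave_on {0<..} (f i)"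
  proof
    assume ?L
    have f1_pos: "0 < f i 1" if "i \<in> ?I" for i
      using strictly_concave_nonneg_imp_pos[of "f i" 1] strict f_nonneg that by auto
    \<comment> \<open>A single factor \<open>d i < f i 1\<close> would make the product strictly smaller, since the remaining
      \<open>f j 1\<close> are positive.\<close>
    have d_eq: "d i = f i 1" if i: "i \<in> ?I" for i
    proof (rule ccontr)
      assume "d i \<noteq> f i 1"
      then have "d i < f i 1"
        using jensen(2)[OF i] by simp
      have "(\<Prod>j\<in>?I. d j) = d i * (\<Prod>j\<in>?I - {i}. d j)"
        using i by (intro prod.remove) auto
      also have "\<dots> \<le> d i * (\<Prod>j\<in>?I - {i}. f j 1)"
        using d_nonneg jensen(2) i by (intro mult_left_mono prod_mono) auto
      also have "\<dots> < f i 1 * (\<Prod>j\<in>?I - {i}. f j 1)"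
        using \<open>d i < f i 1\<close> f1_pos by (intro mult_strict_right_mono prod_pos) auto
      also have "\<dots> = (\<Prod>j\<in>?I. f j 1)"
        using i by (intro prod.remove[symmetric]) auto
      finally show False
        using \<open>?L\<close> by simp
    qed
    have pq: "AE x in M. p i x = q i x" if "i \<in> ?I" for i
      using jensen(3)[OF that] strict d_eq that by auto
    \<comment> \<open>By \<open>pq\<close>, the normalised function \<open>g i / d i\<close> is just \<open>q i\<close>, so equality in Hoelder's inequality
      identifies the \<open>q i\<close> with each other; \<open>q 1\<close> serves as the common density.\<close>
    have "AE x in M. \<forall>i\<in>?I. \<forall>j\<in>?I. g i x / d i = g j x / d j"
      using holder(3) \<open>?L\<close> d_eq f1_pos by simp
    moreover have "AE x in M. \<forall>i\<in>?I. 0 < q i x \<and> p i x = q i x"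
      using pos pq by (simp add: AE_finite_all)
    ultimately have all: "AE x in M. \<forall>i\<in>?I. p i x = q 1 x \<and> q i x = q 1 x"
    proof eventually_elim
      case (elim x)
      have "g i x / d i = q i x" if "i \<in> ?I" for i
        using elim(2) that d_eq[OF that] f1_pos[OF that] by (simp add: g_def)
      then have "q i x = q 1 x" if "i \<in> ?I" for i
        using elim(1) that assms(1) by (metis atLeastAtMost_iff order_refl)
      then show ?case
        using elim(2) by metis
    qed
    have "\<forall>i\<in>?I. AE x in M. p i x = q 1 x \<and> q i x = q 1 x"
      using all by (simp add: AE_finite_all del: AE_conj_iff)
    then show ?R
      using pd(2)[of 1] assms(1) by auto
  next
    assume ?R
    then obtain r where r: "probability_density M r"
      and pqr: "\<And>i. i \<in> ?I \<Longrightarrow> AE x in M. p i x = r x \<and> q i x = r x"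
      by blast
    define K where "K = (\<Prod>i\<in>?I. f i 1 powr (1 / n))"
    have r_meas [measurable]: "r \<in> borel_measurable M"
      using r by (simp add: probability_density_def)
    have g_meas: "g i \<in> borel_measurable M" if "i \<in> ?I" for i
      using jensen(1)[OF that] by auto
    have g_eq: "AE x in M. 0 < r x \<and> g i x = f i 1 * r x" if "i \<in> ?I" for i
      using pqr[OF that] pos(2)[OF that] by eventually_elim (auto simp: g_def)
    have d_eq: "d i = f i 1" if "i \<in> ?I" for i
    proof -
      have "d i = (\<integral>x. f i 1 * r x \<partial>M)"
        unfolding d_def using g_eq[OF that] g_meas[OF that] by (intro integral_cong_AE) auto
      then show ?thesis
        using probability_density_integral[OF r] by simp
    qed
    have "AE x in M. \<forall>i\<in>?I. 0 < r x \<and> g i x = f i 1 * r x"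
      using g_eq by (simp add: AE_finite_all)
    then have "AE x in M. G x = K * r x"
    proof eventually_elim
      case (elim x)
      then have rx: "0 < r x"
        using I by blast
      have "G x = (\<Prod>i\<in>?I. f i 1 powr (1 / n) * r x powr (1 / n))"
        unfolding G_def using elim by (intro prod.cong) (auto simp: powr_mult)
      also have "\<dots> = K * (r x powr (1 / n)) ^ n"
        by (simp add: K_def prod.distrib)
      also have "(r x powr (1 / n)) ^ n = r x"
        using rx assms(1) by (simp add: powr_inverse_power)
      finally show ?case .
    qed
    then have "m = (\<integral>x. K * r x \<partial>M)"
      unfolding m_def using holder(1) by (intro integral_cong_AE) auto
    then have "m = K"
      using probability_density_integral[OF r] by simp
    moreover have "(f i 1 powr (1 / n)) ^ n = f i 1" if "i \<in> ?I" for i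
      using f_nonneg[OF that, of 1] assms(1) by (simp add: powr_inverse_power)
    then have "K ^ n = (\<Prod>i\<in>?I. f i 1)"
      unfolding K_def prod_power_distrib by (intro prod.cong refl)
    ultimately show ?L
      using d_eq by simp
  qed
  show ?thesis
    unfolding mixed_pow prod_D
    using first second equality prod_d_nonneg f1_nonneg m_nonneg
    by (simp add: ennreal_le_iff ennreal_inj)
qed

end
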